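(* For every positive integer $L$, the quadrahelix $\mathrm{QH}_L=(T_1,\dots,T_{4L+2})$ is embedded; that is, for all $1\le i<j\le 4L+2$ the interiors of the solid tetrahedra $T_i$ and $T_j$ are disjoint.
   Context: Basic points: let $r=\frac{3\sqrt3}{10}$, $h=\frac1{\sqrt{10}}$, $\theta=\cos^{-1}(-\frac23)$, and for $i\in\mathbb Z$ let $V_i=(r\cos(i\theta),\,r\sin(i\theta),\,ih)\in\mathbb R^3$. Let $T_0$ be the regular tetrahedron of side 1 with ordered vertices $(V_{-1},V_0,V_1,V_2)$, carrying labels $1,2,3,4$ respectively. Chains from strings: if $T$ is a regular tetrahedron with ordered (labelled) vertices $1,2,3,4$, then reflecting $T$ in face $i$ means replacing the vertex labelled $i$ by its mirror image in the plane of the face opposite to it (the other three vertices and all labels being kept). A string $r_0,r_1,\dots,r_{n-1}$ in $\{1,2,3,4\}$ with consecutive entries distinct determines labelled tetrahedra $T_1,\dots,T_n$, where $T_{k}$ is obtained from $T_{k-1}$ by reflecting in face $r_{k-1}$ ($1\le k\le n$). The chain is $(T_1,\dots,T_n)$; $T_0$ is only an auxiliary "invisible" tetrahedron, not part of the chain. Quadrahelix: let $S_m$ be the $m$-term string $2,3,4,1,2,3,4,1,\dots$ (its $k$-th term is the element of $\{1,2,3,4\}$ congruent to $k+1$ mod 4). For even $m$ let $\Sigma_m$ be $S_{m+1}$ with its middle entry deleted. For a string $s$ let $\overline{s}$ be its reversal. For a positive integer $L$, the quadrahelix $\mathrm{QH}_L$ is the chain of $4L+2$ tetrahedra $T_1,\dots,T_{4L+2}$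 determined by the string (of length $4L+2$, starting with $r_0=1$) $\;1\ \Sigma_{2L}\ j\ \overline{\Sigma_{2L}}$, where $j=3$ if $L$ is even and $j=1$ if $L$ is odd. *)

theory Defs
  imports "HOL-Analysis.Analysis"
begin

definition helix_r :: real where "helix_r = 3 * sqrt 3 / 10"

definition helix_h :: real where "helix_h = 1 / sqrt 10"

definition helix_theta :: real where "helix_theta = arccos (- 2 / 3)"

definition helix_V :: "int \<Rightarrow> real ^ 3" where
  "helix_V i = vector [helix_r * cos (of_int i * helix_theta),
                       helix_r * sin (of_int i * helix_theta),
                       of_int i * helix_h]"

text \<open>
  A labelled tetrahedron is a function on the labels 1, 2, 3, 4; its values at other
  arguments are never used.
\<close>

type_synonym tetrahedron = "nat \<Rightarrow> real ^ 3"

definition solid :: "tetrahedron \<Rightarrow> (real ^ 3) set" where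
  "solid T = convex hull (T ` {1..4})"

text \<open>For an affine plane the closest point is the foot of the perpendicular.\<close>

definition mirror_image :: "(real ^ 3) set \<Rightarrow> real ^ 3 \<Rightarrow> real ^ 3" where
  "mirror_image P x = 2 *\<^sub>R closest_point P x - x"

definition reflect_in_face :: "nat \<Rightarrow> tetrahedron \<Rightarrow> tetrahedron" where
  "reflect_in_face i T = T(i := mirror_image (affine hull (T ` ({1..4} - {i}))) (T i))"

definition T_init :: tetrahedron where
  "T_init k = helix_V (int k - 2)"

text \<open>
  The chain of a string \<open>s\<close> consists of the tetrahedra \<open>chain_tet s k\<close> with
  \<open>1 \<le> k \<le> length s\<close>; the auxiliary tetrahedron at index 0 does not belong to it.
\<close>

primrec chain_tet :: "nat list \<Rightarrow> nat \<Rightarrow> tetrahedron" where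
  "chain_tet s 0 = T_init"
| "chain_tet s (Suc k) = reflect_in_face (s ! k) (chain_tet s k)"

text \<open>With \<open>k\<close> counted from 1, the \<open>k\<close>-th entry is the label congruent to \<open>k + 1\<close> modulo 4.\<close>

definition S_string :: "nat \<Rightarrow> nat list" where
  "S_string m = map (\<lambda>k. k mod 4 + 1) [1..<m + 1]"

definition delete_middle :: "'a list \<Rightarrow> 'a list" where
  "delete_middle xs = take (length xs div 2) xs @ drop (length xs div 2 + 1) xs"

text \<open>Only used for even \<open>m\<close>, so that the string has odd length and a middle entry.\<close>

definition Sigma_string :: "nat \<Rightarrow> nat list" where
  "Sigma_string m = delete_middle (S_string (m + 1))"

definition QH_string :: "nat \<Rightarrow> nat list" where
  "QH_string L =
     [1] @ Sigma_string (2 * L) @ [if even L then 3 else 1] @ rev (Sigma_string (2 * L))"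

definition QH :: "nat \<Rightarrow> nat \<Rightarrow> tetrahedron" where
  "QH L k = chain_tet (QH_string L) k"

end

theory Submission
  imports Defs
begin

text \<open>
  The quadrahelix is made from one helical arm by two mirrors. Call a tetrahedron by the set of
  its vertices. Up to index \<open>L + 1\<close> the string is the plain cycle of labels and \<open>T\<^sub>k\<close> is
  \<open>{V\<^sub>k\<^sub>-\<^sub>1, \<dots>, V\<^sub>k\<^sub>+\<^sub>2}\<close> (\<open>QH_helix\<close>). Because of the deleted entry the chain turns at \<open>T\<^sub>L\<^sub>+\<^sub>1\<close>: the
  mirror \<open>\<nu>\<close> in the plane bisecting the edge from \<open>V\<^sub>L\<^sub>+\<^sub>1\<close> to \<open>V\<^sub>L\<^sub>+\<^sub>3\<close> fixes \<open>T\<^sub>L\<^sub>+\<^sub>1\<close>, and it carries the first arm,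
  run backwards, to the second one, so that \<open>T\<^sub>L\<^sub>+\<^sub>1\<^sub>+\<^sub>n = \<nu> T\<^sub>L\<^sub>+\<^sub>1\<^sub>-\<^sub>n\<close> (\<open>QH_second_arm\<close>). Since the string continues
  as a palindrome about \<open>j\<close>, the second half is the image of the first half in the mirror \<open>\<mu>\<close> in the
  last face of \<open>T\<^sub>2\<^sub>L\<^sub>+\<^sub>1\<close> (\<open>QH_second_half\<close>). Moreover \<open>\<mu> = \<nu> \<rho> \<nu>\<close>, where \<open>\<rho>\<close> is the mirror in the first
  face of the helix, the plane of \<open>V\<^sub>0\<close>, \<open>V\<^sub>1\<close>, \<open>V\<^sub>2\<close>.

  All pairs are then separated by planes, for three reasons.

  \<^item> Within an arm, the height of \<open>V\<^sub>a\<^sub>+\<^sub>n\<close> above the plane of \<open>V\<^sub>a\<^sub>-\<^sub>1\<close>, \<open>V\<^sub>a\<close>, \<open>V\<^sub>a\<^sub>+\<^sub>1\<close> is a positive multiple of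
    \<open>n sin \<theta> - sin (n \<theta>)\<close>, whose sign is that of \<open>n\<close> because \<open>\<bar>sin (n \<theta>)\<bar> \<le> \<bar>n\<bar> sin \<theta>\<close>
    (\<open>helix_separated\<close>).
  \<^item> The two arms lie on different sides of the plane of \<open>\<nu>\<close>, because \<open>V\<^sub>k\<close> with \<open>k \<le> L + 2\<close> does not lie
    in front of it (\<open>arms_separated\<close>).
  \<^item> The two halves lie on different sides of the plane of \<open>\<mu>\<close> (\<open>halves_separated\<close>). This is the delicate
    part, as the quadrahelix nearly closes up for suitable \<open>L\<close>. After applying \<open>\<nu>\<close> one has to show that
    the vertices \<open>V\<^sub>k\<close> of the arm and their images \<open>\<nu> V\<^sub>k\<close> are not below the first face. For \<open>V\<^sub>k\<close> this is
    the first point. By the second point, \<open>\<nu> V\<^sub>k\<close> arises from \<open>V\<^sub>k\<close> by adding a nonnegative multiple of the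
    normal \<open>m\<close> of \<open>\<nu>\<close>. The inner product of \<open>m\<close> with the normal of the first face is a
    positive multiple of \<open>1 - cos ((L + 1) \<theta>)\<close>, hence nonnegative (\<open>normals_acute\<close>): the mirror only
    raises the vertices.
\<close>

section \<open>Reflecting a regular tetrahedron in a face\<close>

text \<open>
  The vertex opposite to a face of a regular tetrahedron is mirrored to twice the centroid of the face
  minus the vertex. Unlike the closest point in the definition of a mirror image, this expression is
  affine in the vertices, so that it commutes with isometries and can be compared with the linear
  recurrence of the helix.
\<close>

definition vertex_flip :: "nat \<Rightarrow> tetrahedron \<Rightarrow> tetrahedron" where
  "vertex_flip i T = T(i := (2 / 3) *\<^sub>R (\<Sum>k\<in>{1..4} - {i}. T k) - T i)"

lemma sum_labels: "(\<Sum>k\<in>{1..4::nat}. f k) = f 1 + f 2 + f 3 + f 4" for f :: "nat \<Rightarrow> 'a::comm_monoid_add"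
proof -
  have "{1..4::nat} = {1, 2, 3, 4}" by auto
  then show ?thesis by (simp add: add.assoc)
qed

lemma vertex_flip_at:
  assumes "i \<in> {1..4}"
  shows "vertex_flip i T i = (2 / 3) *\<^sub>R (T 1 + T 2 + T 3 + T 4) - (5 / 3) *\<^sub>R T i"
proof -
  have "(\<Sum>k\<in>{1..4} - {i}. T k) = (T 1 + T 2 + T 3 + T 4) - T i"
    using sum_diff1[of "{1..4}" T i] assms unfolding sum_labels by auto
  then have "vertex_flip i T i = (2 / 3) *\<^sub>R (T 1 + T 2 + T 3 + T 4) - ((2 / 3) *\<^sub>R T i + T i)"
    by (simp add: vertex_flip_def scaleR_diff_right)
  moreover have "(2 / 3) *\<^sub>R T i + T i = (5 / 3) *\<^sub>R T i"
    using scaleR_left_distrib[of "2/3" 1 "T i"] by simp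
  ultimately show ?thesis by simp
qed

lemma vertex_flip_other: "k \<noteq> i \<Longrightarrow> vertex_flip i T k = T k"
  by (simp add: vertex_flip_def)

text \<open>
  Values at labels outside \<open>{1..4}\<close> are junk, so equality of functions is too strong a relation
  between labelled tetrahedra.
\<close>

definition agree :: "tetrahedron \<Rightarrow> tetrahedron \<Rightarrow> bool" where
  "agree T T' \<longleftrightarrow> (\<forall>l\<in>{1..4}. T l = T' l)"

lemma agree_vertex_flip:
  assumes "agree T T'" "i \<in> {1..4}"
  shows "agree (vertex_flip i T) (vertex_flip i T')"
  unfolding agree_def
proof
  fix l :: nat assume l: "l \<in> {1..4}"
  have "T 1 = T' 1" "T 2 = T' 2" "T 3 = T' 3" "T 4 = T' 4" "T l = T' l"
    using assms(1) l by (auto simp: agree_def)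
  then show "vertex_flip i T l = vertex_flip i T' l"
    by (cases "l = i") (simp_all only: vertex_flip_at[OF assms(2)] vertex_flip_other not_False_eq_True)
qed

lemma agree_trans: "agree S T \<Longrightarrow> agree T U \<Longrightarrow> agree S U"
  by (simp add: agree_def)

lemma vertex_flip_flip:
  assumes "i \<in> {1..4}"
  shows "vertex_flip i (vertex_flip i T) = T"
proof -
  have "(\<Sum>k\<in>{1..4} - {i}. vertex_flip i T k) = (\<Sum>k\<in>{1..4} - {i}. T k)"
    by (intro sum.cong) (auto simp: vertex_flip_other)
  then have "vertex_flip i (vertex_flip i T) i = (2 / 3) *\<^sub>R (\<Sum>k\<in>{1..4} - {i}. T k) - vertex_flip i T i"
    by (simp add: vertex_flip_def[of i "vertex_flip i T"])
  then have "vertex_flip i (vertex_flip i T) i = T i"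
    by (simp add: vertex_flip_def[of i T])
  then show ?thesis by (metis ext vertex_flip_other)
qed

definition unit_regular :: "tetrahedron \<Rightarrow> bool" where
  "unit_regular T \<longleftrightarrow> (\<forall>k\<in>{1..4}. \<forall>l\<in>{1..4}. k \<noteq> l \<longrightarrow> dist (T k) (T l) = 1)"

text \<open>
  By symmetry the foot of the perpendicular from \<open>D\<close> is the centroid \<open>G\<close> of the face:
  with edge vectors \<open>a\<close>, \<open>b\<close>, \<open>c\<close> issuing from \<open>D\<close>, all pairwise inner
  products are \<open>1/2\<close>, and \<open>G - D = (a + b + c) / 3\<close> has the same inner product with each of them.
  The distances of the new vertex show that the result is again a regular tetrahedron of side 1, which
  keeps the formula applicable along the whole chain.
\<close>

lemma mirror_image_regular:
  fixes A B C D :: "real ^ 3"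
  assumes "dist A B = 1" "dist A C = 1" "dist B C = 1" "dist D A = 1" "dist D B = 1" "dist D C = 1"
  defines "D' \<equiv> (2 / 3) *\<^sub>R (A + B + C) - D"
  shows "mirror_image (affine hull {A, B, C}) D = D'"
    and "dist D' A = 1" "dist D' B = 1" "dist D' C = 1"
proof -
  define a b c where abc: "a = A - D" "b = B - D" "c = C - D"
  have sq: "a \<bullet> a = 1" "b \<bullet> b = 1" "c \<bullet> c = 1"
    using assms(4-6) by (simp_all add: abc dist_norm norm_minus_commute dot_square_norm)
  have "(a - b) \<bullet> (a - b) = 1" "(a - c) \<bullet> (a - c) = 1" "(b - c) \<bullet> (b - c) = 1"
    using assms(1-3) by (simp_all add: abc dist_norm dot_square_norm)
  then have ip: "a \<bullet> b = 1/2" "a \<bullet> c = 1/2" "b \<bullet> c = 1/2" "b \<bullet> a = 1/2" "c \<bullet> a = 1/2" "c \<bullet> b = 1/2"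
    using sq by (simp_all add: inner_diff_left inner_diff_right inner_commute)
  define G where "G = (1 / 3) *\<^sub>R (A + B + C)"
  have G: "G - D = (1/3) *\<^sub>R (a + b + c)"
    by (simp add: G_def abc vec_eq_iff field_simps)
  have perp: "(G - D) \<bullet> x = (G - D) \<bullet> G" if "x \<in> affine hull {A, B, C}" for x
  proof -
    have *: "(G - D) \<bullet> (P - D) = (G - D) \<bullet> (G - D)" if "P \<in> {A, B, C}" for P
      using that unfolding G
      by (auto simp: inner_add_left inner_add_right abc[symmetric] sq ip)
    have "(G - D) \<bullet> P = (G - D) \<bullet> G" if "P \<in> {A, B, C}" for P
      using *[OF that] by (simp add: inner_diff_right)
    then have "{A, B, C} \<subseteq> {x. (G - D) \<bullet> x = (G - D) \<bullet> G}" by auto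
    then have "affine hull {A, B, C} \<subseteq> {x. (G - D) \<bullet> x = (G - D) \<bullet> G}"
      by (intro hull_minimal affine_hyperplane)
    then show ?thesis using that by auto
  qed
  have "G \<in> affine hull {A, B, C}"
    unfolding affine_hull_3 G_def mem_Collect_eq
    by (intro exI[of _ "1/3"]) (simp add: scaleR_add_right)
  moreover have "dist D G \<le> dist D x" if "x \<in> affine hull {A, B, C}" for x
  proof -
    have "(x - D) \<bullet> (x - D) = (x - G) \<bullet> (x - G) + 2 * ((G - D) \<bullet> x - (G - D) \<bullet> G) + (G - D) \<bullet> (G - D)"
      by (simp add: inner_diff_left inner_diff_right inner_commute algebra_simps)
    then have "(norm (G - D))\<^sup>2 \<le> (norm (x - D))\<^sup>2"
      using perp[OF that] by (simp add: dot_square_norm)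
    then show ?thesis by (simp add: dist_norm norm_minus_commute)
  qed
  ultimately have "closest_point (affine hull {A, B, C}) D = G"
    by (intro closest_point_unique[symmetric]) (auto simp: affine_imp_convex)
  then show "mirror_image (affine hull {A, B, C}) D = D'"
    by (simp add: mirror_image_def D'_def G_def)
  have D': "D' - D = (2/3) *\<^sub>R (a + b + c)"
    by (simp add: D'_def abc vec_eq_iff field_simps)
  have *: "dist D' P = 1" if "P \<in> {A, B, C}" for P
  proof -
    define p where "p = P - D"
    have p: "p = a \<or> p = b \<or> p = c" using that unfolding p_def abc by auto
    have "D' - P = (2/3) *\<^sub>R (a + b + c) - p"
      by (simp add: D'[symmetric] p_def)
    then have "(D' - P) \<bullet> (D' - P) = 1"
      using p
      by (auto simp: inner_add_left inner_add_right inner_diff_left inner_diff_right sq ip)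
    then show ?thesis by (simp add: dist_norm norm_eq_1)
  qed
  show "dist D' A = 1" "dist D' B = 1" "dist D' C = 1" using * by auto
qed

lemma reflect_in_face_regular:
  assumes "unit_regular T" "i \<in> {1..4}"
  shows "reflect_in_face i T = vertex_flip i T" and "unit_regular (reflect_in_face i T)"
proof -
  obtain j k l where jkl: "{1..4} - {i} = {j, k, l}" "j \<noteq> k" "j \<noteq> l" "k \<noteq> l"
  proof -
    have "i = 1 \<or> i = 2 \<or> i = 3 \<or> i = 4" using assms(2) by auto
    moreover have "{1..4} - {1} = {2, 3, 4::nat}" "{1..4} - {2} = {1, 3, 4::nat}"
      "{1..4} - {3} = {1, 2, 4::nat}" "{1..4} - {4} = {1, 2, 3::nat}" by auto
    ultimately show ?thesis using that[of 2 3 4] that[of 1 3 4] that[of 1 2 4] that[of 1 2 3] by auto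
  qed
  have mem: "j \<in> {1..4}" "k \<in> {1..4}" "l \<in> {1..4}" "j \<noteq> i" "k \<noteq> i" "l \<noteq> i" using jkl(1) by blast+
  then have d: "dist (T j) (T k) = 1" "dist (T j) (T l) = 1" "dist (T k) (T l) = 1"
    "dist (T i) (T j) = 1" "dist (T i) (T k) = 1" "dist (T i) (T l) = 1"
    using assms jkl(2-4) unfolding unit_regular_def by metis+
  have sum: "(\<Sum>k\<in>{1..4} - {i}. T k) = T j + T k + T l"
    unfolding jkl(1) using jkl(2-4) by (simp add: add.assoc)
  show eq: "reflect_in_face i T = vertex_flip i T"
    unfolding reflect_in_face_def vertex_flip_def sum
    unfolding jkl(1) using mirror_image_regular(1)[OF d] by simp
  have flip: "vertex_flip i T i = (2 / 3) *\<^sub>R (T j + T k + T l) - T i"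
    unfolding vertex_flip_def sum by simp
  have new: "dist (vertex_flip i T i) (T n) = 1" if "n \<in> {1..4} - {i}" for n
    using that mirror_image_regular(2-4)[OF d] unfolding flip jkl(1) by auto
  show "unit_regular (reflect_in_face i T)"
    unfolding eq unit_regular_def
  proof (intro ballI impI)
    fix m n :: nat assume "m \<in> {1..4}" "n \<in> {1..4}" "m \<noteq> n"
    then show "dist (vertex_flip i T m) (vertex_flip i T n) = 1"
      using new[of m] new[of n] assms(1)
      by (cases "m = i"; cases "n = i") (auto simp: vertex_flip_other unit_regular_def dist_commute)
  qed
qed

section \<open>Mirrors in planes\<close>

definition mirror :: "real ^ 3 \<Rightarrow> real ^ 3 \<Rightarrow> real ^ 3 \<Rightarrow> real ^ 3" where
  "mirror a c x = x - (2 * ((x - c) \<bullet> a) / (a \<bullet> a)) *\<^sub>R a"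

lemma mirror_mirror [simp]: "mirror a c (mirror a c x) = x"
proof (cases "a = 0")
  case False
  define q where "q = 2 * ((x - c) \<bullet> a) / (a \<bullet> a)"
  have "q * (a \<bullet> a) = 2 * ((x - c) \<bullet> a)" using False by (simp add: q_def)
  moreover have "mirror a c x = x - q *\<^sub>R a" by (simp add: mirror_def q_def)
  ultimately have "(mirror a c x - c) \<bullet> a = - ((x - c) \<bullet> a)"
    by (simp add: inner_diff_left)
  then have "mirror a c (mirror a c x) = mirror a c x + q *\<^sub>R a"
    unfolding mirror_def[of a c "mirror a c x"] by (simp add: q_def)
  then show ?thesis by (simp add: mirror_def q_def)
qed (simp add: mirror_def)

lemma mirror_eqI:
  assumes "a \<bullet> a = 1" "2 * ((x - c) \<bullet> a) = t"
  shows "mirror a c x = x - t *\<^sub>R a"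
  using assms by (simp add: mirror_def)

lemma inner_mirror: "(mirror a c x - c) \<bullet> a = - ((x - c) \<bullet> a)"
  by (cases "a = 0") (simp_all add: mirror_def inner_diff_left)

text \<open>
  Reflecting in a face is a geometric construction, hence equivariant under mirrors. This is what
  turns a symmetry of the string into a symmetry of the chain.
\<close>

lemma mirror_vertex_flip:
  assumes "i \<in> {1..4}"
  shows "mirror a c (vertex_flip i T l) = vertex_flip i (mirror a c \<circ> T) l"
proof (cases "l = i")
  case True
  define q where "q x = 2 * ((x - c) \<bullet> a) / (a \<bullet> a)" for x
  have q: "q ((2/3) *\<^sub>R (x + y + z + w) - (5/3) *\<^sub>R v) = (2/3) * (q x + q y + q z + q w) - (5/3) * q v" for x y z w v
    unfolding q_def by (cases "a = 0") (auto simp: field_simps inner_diff_left inner_add_left)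
  have m: "mirror a c x = x - q x *\<^sub>R a" for x by (simp add: mirror_def q_def)
  show ?thesis unfolding True vertex_flip_at[OF assms] comp_def m q
    by (simp add: algebra_simps)
qed (simp add: vertex_flip_other)

section \<open>Separating planes\<close>

text \<open>
  A plane that separates the vertices separates the solids, because half-spaces are convex.
\<close>

definition separated :: "tetrahedron \<Rightarrow> tetrahedron \<Rightarrow> bool" where
  "separated T T' \<longleftrightarrow> (\<exists>n d. n \<noteq> 0 \<and> (\<forall>l\<in>{1..4}. n \<bullet> T l \<le> d \<and> d \<le> n \<bullet> T' l))"

lemma separated_commute: "separated T T' \<Longrightarrow> separated T' T"
proof -
  assume "separated T T'"
  then obtain n d where "n \<noteq> 0" "\<forall>l\<in>{1..4}. n \<bullet> T l \<le> d \<and> d \<le> n \<bullet> T' l"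
    unfolding separated_def by blast
  then show ?thesis unfolding separated_def
    by (intro exI[of _ "-n"] exI[of _ "-d"]) auto
qed

lemma separated_agree:
  assumes "separated S S'" "agree T S" "agree T' S'"
  shows "separated T T'"
  using assms unfolding separated_def agree_def by metis

lemma separated_interior:
  assumes "separated T T'"
  shows "interior (solid T) \<inter> interior (solid T') = {}"
proof -
  obtain n d where n: "n \<noteq> 0" "\<forall>l\<in>{1..4}. n \<bullet> T l \<le> d \<and> d \<le> n \<bullet> T' l"
    using assms unfolding separated_def by blast
  have "solid T \<subseteq> {x. n \<bullet> x \<le> d}"
    unfolding solid_def by (rule hull_minimal) (use n convex_halfspace_le in auto)
  then have "interior (solid T) \<subseteq> {x. n \<bullet> x < d}"
    using interior_mono interior_halfspace_le[OF n(1)] by metis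
  moreover have "solid T' \<subseteq> {x. n \<bullet> x \<ge> d}"
    unfolding solid_def by (rule hull_minimal) (use n convex_halfspace_ge in auto)
  then have "interior (solid T') \<subseteq> {x. n \<bullet> x > d}"
    using interior_mono interior_halfspace_ge[OF n(1)] by metis
  ultimately show ?thesis by fastforce
qed

text \<open>
  If \<open>n\<close> is a normal of a plane separating the images, its image under the linear part of the mirror
  is a normal of a plane separating the originals.
\<close>

lemma separated_mirrorD:
  assumes "separated (\<lambda>l. mirror a c (T l)) (\<lambda>l. mirror a c (T' l))"
  shows "separated T T'"
proof -
  obtain n d where n: "n \<noteq> 0" "\<forall>l\<in>{1..4}. n \<bullet> mirror a c (T l) \<le> d \<and> d \<le> n \<bullet> mirror a c (T' l)"
    using assms unfolding separated_def by blast
  define n' where "n' = mirror a 0 n"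
  define e where "e = 2 * (n \<bullet> a) * (c \<bullet> a) / (a \<bullet> a)"
  have eq: "n \<bullet> mirror a c x = n' \<bullet> x + e" for x
    by (cases "a = 0") (simp_all add: n'_def e_def mirror_def inner_diff_left inner_diff_right inner_commute field_simps)
  have "n' \<noteq> 0"
  proof
    assume "n' = 0"
    then have "mirror a 0 n' = 0" by (simp add: mirror_def)
    then show False using n(1) by (simp add: n'_def)
  qed
  with n show ?thesis unfolding separated_def eq
    by (intro exI[of _ n'] exI[of _ "d - e"]) (auto simp: algebra_simps)
qed

lemma separated_mirrorI:
  assumes "separated T T'"
  shows "separated (\<lambda>l. mirror a c (T l)) (\<lambda>l. mirror a c (T' l))"
  by (rule separated_mirrorD[of a c]) (simp add: assms)

section \<open>The helix and its planes\<close>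

lemma inner_3: "(x :: real ^ 3) \<bullet> y = x $ 1 * y $ 1 + x $ 2 * y $ 2 + x $ 3 * y $ 3"
  by (simp add: inner_vec_def sum_3)

lemma helix_r_sq: "helix_r\<^sup>2 = 27 / 100"
  by (simp add: helix_r_def power_mult_distrib power_divide)

lemma helix_h_sq: "helix_h\<^sup>2 = 1 / 10"
  by (simp add: helix_h_def power_divide)

lemma helix_rh_pos: "helix_r > 0" "helix_h > 0"
  by (simp_all add: helix_r_def helix_h_def)

lemma cos_theta: "cos helix_theta = - 2 / 3"
  unfolding helix_theta_def by (rule cos_arccos) auto

lemma sin_theta_sq: "(sin helix_theta)\<^sup>2 = 5 / 9"
  using sin_squared_eq[of helix_theta] by (simp add: cos_theta power_divide)

lemma sin_theta_pos: "sin helix_theta > 0"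
proof -
  have "sin helix_theta \<ge> 0"
    unfolding helix_theta_def by (intro sin_ge_zero arccos_lbound arccos_ubound) auto
  then show ?thesis using sin_theta_sq by (cases "sin helix_theta = 0") auto
qed

lemma cos_multiples:
  "cos (2 * helix_theta) = - 1 / 9" "cos (3 * helix_theta) = 22 / 27"
  "cos (4 * helix_theta) = - 79 / 81"
proof -
  show c2: "cos (2 * helix_theta) = - 1 / 9"
    by (simp add: cos_double_cos cos_theta power_divide)
  show "cos (3 * helix_theta) = 22 / 27"
    by (simp add: cos_treble_cos cos_theta power_divide)
  have "4 * helix_theta = 2 * (2 * helix_theta)" by simp
  then show "cos (4 * helix_theta) = - 79 / 81"
    by (simp only: cos_double_cos[of "2 * helix_theta"] c2) (simp add: power_divide)
qed

lemma sin_multiples: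
  "sin (2 * helix_theta) = - 4 / 3 * sin helix_theta"
  "sin (3 * helix_theta) = 7 / 9 * sin helix_theta"
  "sin (4 * helix_theta) = 8 / 27 * sin helix_theta"
proof -
  show s2: "sin (2 * helix_theta) = - 4 / 3 * sin helix_theta"
    by (simp add: sin_double cos_theta)
  have "3 * helix_theta = 2 * helix_theta + helix_theta" by simp
  then have "sin (3 * helix_theta) = sin (2 * helix_theta) * cos helix_theta + cos (2 * helix_theta) * sin helix_theta"
    by (metis sin_add)
  then show "sin (3 * helix_theta) = 7 / 9 * sin helix_theta"
    by (simp add: s2 cos_theta cos_multiples)
  have "4 * helix_theta = 2 * (2 * helix_theta)" by simp
  then show "sin (4 * helix_theta) = 8 / 27 * sin helix_theta"
    by (simp only: sin_double[of "2 * helix_theta"] s2 cos_multiples)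
qed

lemma helix_V_nth [simp]:
  "helix_V i $ 1 = helix_r * cos (of_int i * helix_theta)"
  "helix_V i $ 2 = helix_r * sin (of_int i * helix_theta)"
  "helix_V i $ 3 = of_int i * helix_h"
  by (simp_all add: helix_V_def)

lemma helix_angle_add: "of_int (i + k) * helix_theta = of_int i * helix_theta + of_int k * helix_theta"
  by (simp add: distrib_right)

text \<open>
  This is the statement that \<open>V\<^sub>i\<^sub>+\<^sub>4\<close> is the mirror image of \<open>V\<^sub>i\<close> in the plane of the three
  vertices in between. The polynomial \<open>x^4 - (2/3) (x^3 + x^2 + x) + 1\<close> of the recurrence is
  \<open>(x - 1)^2 (x^2 + (4/3) x + 1)\<close>; its roots are the double root 1, for the linear third coordinate,
  and \<open>exp (\<plusminus> i \<theta>)\<close>, for the rotation.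
\<close>

lemma helix_recurrence:
  "helix_V (i + 4) = (2 / 3) *\<^sub>R (helix_V (i + 1) + helix_V (i + 2) + helix_V (i + 3)) - helix_V i"
  unfolding vec_eq_iff forall_3 vector_minus_component vector_add_component vector_scaleR_component
    helix_V_nth helix_angle_add cos_add sin_add
  by (simp add: cos_theta cos_multiples sin_multiples) (simp add: field_simps)

lemma dist_helix_V_sq:
  "(dist (helix_V i) (helix_V j))\<^sup>2 = 27 / 50 * (1 - cos (of_int (i - j) * helix_theta)) + (of_int (i - j))\<^sup>2 / 10"
proof -
  have c: "cos (of_int (i - j) * helix_theta) = cos (of_int i * helix_theta) * cos (of_int j * helix_theta)
     + sin (of_int i * helix_theta) * sin (of_int j * helix_theta)"
    by (simp add: left_diff_distrib cos_diff)
  have s: "(sin x)\<^sup>2 = 1 - (cos x)\<^sup>2" for x :: real by (rule sin_squared_eq)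
  have "(dist (helix_V i) (helix_V j))\<^sup>2 = (helix_V i - helix_V j) \<bullet> (helix_V i - helix_V j)"
    by (simp add: dist_norm dot_square_norm)
  also have "\<dots> = helix_r\<^sup>2 * (2 - 2 * cos (of_int (i - j) * helix_theta)) + (of_int (i - j))\<^sup>2 * helix_h\<^sup>2"
    unfolding c inner_3 using s[of "of_int i * helix_theta"] s[of "of_int j * helix_theta"]
    by simp algebra
  finally show ?thesis by (simp add: helix_r_sq helix_h_sq)
qed

lemma dist_helix_V:
  assumes "i \<noteq> j" "\<bar>i - j\<bar> \<le> 3"
  shows "dist (helix_V i) (helix_V j) = 1"
proof -
  have *: "dist (helix_V (k + d)) (helix_V k) = 1" if "d = 1 \<or> d = 2 \<or> d = 3" for k d
  proof -
    have "(dist (helix_V (k + d)) (helix_V k))\<^sup>2 = 1"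
      unfolding dist_helix_V_sq using that
      by (auto simp: cos_theta cos_multiples)
    then show ?thesis by (metis abs_1 power2_eq_1_iff zero_le_dist abs_of_nonneg abs_minus_cancel)
  qed
  have "i - j = 1 \<or> i - j = 2 \<or> i - j = 3 \<or> j - i = 1 \<or> j - i = 2 \<or> j - i = 3"
    using assms by presburger
  then show ?thesis using *[of "i - j" j] *[of "j - i" i] by (auto simp: dist_commute)
qed

text \<open>
  A normal of the plane through \<open>V\<^sub>a\<^sub>-\<^sub>1\<close>, \<open>V\<^sub>a\<close>, \<open>V\<^sub>a\<^sub>+\<^sub>1\<close>, chosen with positive third coordinate. Up to
  the rotation by \<open>a \<theta>\<close> it is \<open>(0, - h, r sin \<theta>)\<close>, which is orthogonal to
  \<open>V\<^sub>1 - V\<^sub>-\<^sub>1 = (0, 2 r sin \<theta>, 2 h)\<close> and to \<open>V\<^sub>1 + V\<^sub>-\<^sub>1 - 2 V\<^sub>0\<close>, which points along the first axis.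
\<close>

definition face_normal :: "int \<Rightarrow> real ^ 3" where
  "face_normal a = vector [helix_h * sin (of_int a * helix_theta),
     - helix_h * cos (of_int a * helix_theta), helix_r * sin helix_theta]"

lemma face_normal_nth [simp]:
  "face_normal a $ 1 = helix_h * sin (of_int a * helix_theta)"
  "face_normal a $ 2 = - helix_h * cos (of_int a * helix_theta)"
  "face_normal a $ 3 = helix_r * sin helix_theta"
  by (simp_all add: face_normal_def)

lemma face_normal_nonzero: "face_normal a \<noteq> 0"
proof
  assume "face_normal a = 0"
  then have "face_normal a $ 3 = 0" by simp
  then show False using helix_rh_pos sin_theta_pos by simp
qed

lemma abs_sin_of_nat_mult: "\<bar>sin (of_nat n * x)\<bar> \<le> of_nat n * \<bar>sin (x::real)\<bar>"
proof (induction n)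
  case (Suc n)
  have "\<bar>sin (of_nat n * x) * cos x\<bar> \<le> \<bar>sin (of_nat n * x)\<bar>" "\<bar>cos (of_nat n * x) * sin x\<bar> \<le> \<bar>sin x\<bar>"
    by (simp_all add: abs_mult mult_left_le mult_left_le_one_le)
  moreover have "sin (of_nat (Suc n) * x) = sin (of_nat n * x) * cos x + cos (of_nat n * x) * sin x"
    by (simp add: distrib_right sin_add add.commute)
  ultimately show ?case using Suc by (simp add: distrib_right)
qed simp

text \<open>
  Up to a positive factor this is the height of \<open>V\<^sub>a\<^sub>+\<^sub>n\<close> above the plane through
  \<open>V\<^sub>a\<^sub>-\<^sub>1\<close>, \<open>V\<^sub>a\<close>, \<open>V\<^sub>a\<^sub>+\<^sub>1\<close>. Its sign is settled by \<open>\<bar>sin (n \<theta>)\<bar> \<le> \<bar>n\<bar> sin \<theta>\<close>: every such plane has the earlier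
  vertices of the helix weakly below and the later ones weakly above.
\<close>

definition sine_gap :: "int \<Rightarrow> real" where
  "sine_gap n = of_int n * sin helix_theta - sin (of_int n * helix_theta)"

lemma face_normal_inner:
  "face_normal a \<bullet> (helix_V k - helix_V a) = helix_h * helix_r * sine_gap (k - a)"
proof -
  have s: "sin (of_int (k - a) * helix_theta) = sin (of_int k * helix_theta) * cos (of_int a * helix_theta)
     - cos (of_int k * helix_theta) * sin (of_int a * helix_theta)"
    by (simp add: left_diff_distrib sin_diff)
  show ?thesis unfolding sine_gap_def s inner_3 by (simp add: algebra_simps)
qed

lemma sine_gap_minus: "sine_gap (- n) = - sine_gap n"
  by (simp add: sine_gap_def)

lemma sine_gap_nonneg: "sine_gap n \<ge> 0" if "n \<ge> -1"
proof (cases "n = -1")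
  case False
  then have "0 \<le> n" using that by linarith
  then obtain m where "n = int m" by (rule nonneg_int_cases)
  then show ?thesis
    using abs_sin_of_nat_mult[of m helix_theta] sin_theta_pos by (simp add: sine_gap_def)
qed (simp add: sine_gap_def)

lemma sine_gap_nonpos: "sine_gap n \<le> 0" if "n \<le> 1"
  using sine_gap_nonneg[of "- n"] that by (simp add: sine_gap_minus)

text \<open>
  A normal of the plane that bisects the edge from \<open>V\<^sub>b\<^sub>-\<^sub>1\<close> to \<open>V\<^sub>b\<^sub>+\<^sub>1\<close>. The plane passes through \<open>V\<^sub>b\<close>
  and \<open>V\<^sub>b\<^sub>-\<^sub>2\<close>, which have distance 1 from both ends of the edge.
\<close>

definition bisector_normal :: "int \<Rightarrow> real ^ 3" where
  "bisector_normal b = helix_V (b + 1) - helix_V (b - 1)"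

lemma bisector_normal_unit: "bisector_normal b \<bullet> bisector_normal b = 1"
  using dist_helix_V[of "b + 1" "b - 1"] unfolding bisector_normal_def by (simp add: dist_norm dot_square_norm)

lemma bisector_normal_nth:
  "bisector_normal b $ 1 = - (2 * helix_r * sin helix_theta * sin (of_int b * helix_theta))"
  "bisector_normal b $ 2 = 2 * helix_r * sin helix_theta * cos (of_int b * helix_theta)"
  "bisector_normal b $ 3 = 2 * helix_h"
  unfolding bisector_normal_def by (simp_all add: distrib_right left_diff_distrib sin_add cos_add sin_diff cos_diff algebra_simps)

lemma bisector_normal_inner:
  "(helix_V (b + n) - helix_V b) \<bullet> bisector_normal b
    = 27 / 50 * sin helix_theta * sin (of_int n * helix_theta) + of_int n / 5"
proof -
  have ring: "(r * (cb * cn - sb * sn) - r * cb) * - (2 * r * S * sb)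
      + (r * (sb * cn + cb * sn) - r * sb) * (2 * r * S * cb) + ((b' + n') * h - b' * h) * (2 * h)
    = 2 * r\<^sup>2 * S * sn * (sb\<^sup>2 + cb\<^sup>2) + 2 * n' * h\<^sup>2" for r cb sb cn sn S b' n' h :: real
    by (simp add: algebra_simps power2_eq_square)
  have "(helix_V (b + n) - helix_V b) \<bullet> bisector_normal b
     = 2 * helix_r\<^sup>2 * sin helix_theta * sin (of_int n * helix_theta) + 2 * of_int n * helix_h\<^sup>2"
    unfolding inner_3 bisector_normal_nth vector_minus_component helix_V_nth helix_angle_add sin_add cos_add
    unfolding of_int_add ring by simp
  then show ?thesis by (simp add: helix_r_sq helix_h_sq)
qed

lemma bisector_normal_inner_near:
  "(helix_V (b + 1) - helix_V b) \<bullet> bisector_normal b = 1 / 2"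
  "(helix_V (b - 1) - helix_V b) \<bullet> bisector_normal b = - 1 / 2"
  "(helix_V (b - 2) - helix_V b) \<bullet> bisector_normal b = 0"
  using bisector_normal_inner[of b 1] bisector_normal_inner[of b "-1"] bisector_normal_inner[of b "-2"] sin_theta_sq
  by (simp_all add: sin_multiples power2_eq_square)

text \<open>
  Going back from \<open>V\<^sub>b\<close>, the height falls by \<open>1/5\<close> per step, apart from an oscillation of amplitude
  \<open>27/50 sin \<theta>\<close>. Three steps back the linear term \<open>3/5\<close> already exceeds the amplitude, and the three
  nearer vertices lie on the plane or strictly below it.
\<close>

lemma bisector_separates: "(helix_V k - helix_V b) \<bullet> bisector_normal b \<le> 0" if "k \<le> b"
proof -
  have "k = b \<or> k = b - 1 \<or> k = b - 2 \<or> k \<le> b - 3" using that by arith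
  then consider "k = b" | "k = b - 1" | "k = b - 2" | "k \<le> b - 3" by blast
  then show ?thesis
  proof cases
    case 4
    define n where "n = k - b"
    have n: "k = b + n" "n \<le> -3" using 4 by (auto simp: n_def)
    \<comment> \<open>A rational bound with \<open>27/50 * 3/4 < 3/5\<close>; the sine is \<open>\<surd>5 / 3\<close>.\<close>
    have "sin helix_theta \<le> 3/4"
      using sin_theta_sq power2_le_imp_le[of "sin helix_theta" "3/4"] by (auto simp: power_divide)
    moreover have "sin helix_theta * sin (of_int n * helix_theta) \<le> sin helix_theta * 1"
      using sin_theta_pos by (intro mult_left_mono) auto
    moreover have "real_of_int n \<le> -3" using n(2) by linarith
    ultimately show ?thesis unfolding n(1) bisector_normal_inner by linarith
  qed (use bisector_normal_inner_near[of b] in auto)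
qed

text \<open>
  The angles that the two normals make with the axis of the helix add up to a right angle, so the
  vertical part of the inner product cancels the horizontal part when the horizontal components are opposite.
  The inner product is therefore a multiple of \<open>1 - cos ((b - a) \<theta>)\<close>. It has no positive lower bound
  as \<open>b - a\<close> varies, which is the reason why long quadrahelices can be arbitrarily close to closing up.
\<close>

lemma normals_acute: "face_normal a \<bullet> bisector_normal b \<ge> 0"
proof -
  have "face_normal a \<bullet> bisector_normal b
     = 2 * helix_h * helix_r * sin helix_theta * (1 - cos (of_int (b - a) * helix_theta))"
    unfolding inner_3 bisector_normal_nth
    by (simp add: left_diff_distrib cos_diff algebra_simps)
  then show ?thesis using helix_rh_pos sin_theta_pos by simp
qed

section \<open>Labels along the helix\<close>

text \<open>
  The tetrahedron on \<open>V\<^sub>k\<^sub>-\<^sub>1, \<dots>, V\<^sub>k\<^sub>+\<^sub>2\<close>, in which \<open>V\<^sub>i\<close> carries the label congruent to \<open>i + 2\<close>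
  modulo 4. A vertex thus keeps its label while the window of indices moves on.
\<close>

definition helix_tet :: "nat \<Rightarrow> tetrahedron" where
  "helix_tet k l = helix_V (int k - 1 + (int l - int k - 1) mod 4)"

lemma helix_tet_label:
  assumes "l = (k + d) mod 4 + 1" "d < 4"
  shows "helix_tet k l = helix_V (int k - 1 + int d)"
proof -
  have "(int l - int k - 1) mod 4 = int d"
    using assms by (simp add: zmod_int mod_diff_left_eq)
  then show ?thesis by (simp add: helix_tet_def)
qed

lemma label_cases:
  assumes "l \<in> {1..4::nat}"
  obtains d where "d < 4" "l = (k + d) mod 4 + 1"
proof -
  have "\<exists>d<4. l = (k + d) mod 4 + 1" using assms unfolding atLeastAtMost_iff by presburger
  then show ?thesis using that by blast
qed

lemma helix_tet_range:
  assumes "l \<in> {1..4}"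
  obtains n where "helix_tet k l = helix_V n" "int k - 1 \<le> n" "n \<le> int k + 2"
proof -
  obtain d where "d < 4" "l = (k + d) mod 4 + 1" using label_cases[OF assms] .
  then show ?thesis using that[of "int k - 1 + int d"] helix_tet_label by simp
qed

text \<open>
  The label \<open>k mod 4 + 1\<close> sits on the oldest vertex \<open>V\<^sub>k\<^sub>-\<^sub>1\<close>, which the recurrence replaces
  by \<open>V\<^sub>k\<^sub>+\<^sub>3\<close>.
\<close>

lemma helix_tet_step: "agree (vertex_flip (k mod 4 + 1) (helix_tet k)) (helix_tet (Suc k))"
  unfolding agree_def
proof
  fix l :: nat assume "l \<in> {1..4}"
  then obtain d where d: "d < 4" "l = (k + d) mod 4 + 1" by (rule label_cases)
  have shift: "(k + m) mod 4 = (k mod 4 + m) mod 4" for m by (simp add: mod_add_left_eq)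
  have residue: "k mod 4 = 0 \<or> k mod 4 = 1 \<or> k mod 4 = 2 \<or> k mod 4 = 3" by presburger
  have rest: "{1..4} - {k mod 4 + 1} = {(k + 1) mod 4 + 1, (k + 2) mod 4 + 1, (k + 3) mod 4 + 1}"
    unfolding shift[of 1] shift[of 2] shift[of 3] using residue by (elim disjE) auto
  have ne: "(k + 1) mod 4 + 1 \<noteq> (k + 2) mod 4 + 1" "(k + 1) mod 4 + 1 \<noteq> (k + 3) mod 4 + 1"
    "(k + 2) mod 4 + 1 \<noteq> (k + 3) mod 4 + 1"
    unfolding shift[of 1] shift[of 2] shift[of 3] using residue by (elim disjE; simp)+
  show "vertex_flip (k mod 4 + 1) (helix_tet k) l = helix_tet (Suc k) l"
  proof (cases "d = 0")
    case True
    have "(\<Sum>m\<in>{1..4} - {k mod 4 + 1}. helix_tet k m)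
        = helix_tet k ((k + 1) mod 4 + 1) + helix_tet k ((k + 2) mod 4 + 1) + helix_tet k ((k + 3) mod 4 + 1)"
      unfolding rest using ne by (simp add: add.assoc)
    also have "\<dots> = helix_V (int k) + helix_V (int k + 1) + helix_V (int k + 2)"
      using helix_tet_label[of _ k 1, OF refl] helix_tet_label[of _ k 2, OF refl] helix_tet_label[of _ k 3, OF refl]
      by (simp add: algebra_simps)
    finally have "vertex_flip (k mod 4 + 1) (helix_tet k) (k mod 4 + 1)
      = (2 / 3) *\<^sub>R (helix_V (int k) + helix_V (int k + 1) + helix_V (int k + 2)) - helix_V (int k - 1)"
      using helix_tet_label[of _ k 0, OF refl] by (simp add: vertex_flip_def)
    also have "\<dots> = helix_V (int k + 3)"
      using helix_recurrence[of "int k - 1"] by (simp add: algebra_simps)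
    also have "\<dots> = helix_tet (Suc k) (k mod 4 + 1)"
      using helix_tet_label[of "k mod 4 + 1" "Suc k" 3] by (simp add: algebra_simps)
    finally show ?thesis using True d by simp
  next
    case False
    then obtain e where e: "d = Suc e" by (cases d) auto
    have "d = 1 \<or> d = 2 \<or> d = 3" using d(1) False by linarith
    then have "l \<noteq> k mod 4 + 1" using d(2) residue shift[of d] by auto
    then show ?thesis
      using helix_tet_label[of l k d] helix_tet_label[of l "Suc k" e] d e
      by (simp add: vertex_flip_other)
  qed
qed

lemma helix_tet_step_back: "agree (vertex_flip (k mod 4 + 1) (helix_tet (Suc k))) (helix_tet k)"
proof -
  have i: "k mod 4 + 1 \<in> {1..4}" by (simp add: Suc_le_eq)
  show ?thesis
    using agree_vertex_flip[OF helix_tet_step[of k] i] unfolding vertex_flip_flip[OF i] agree_def by simp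
qed

text \<open>
  The exchange of the labels that \<open>V\<^sub>L\<^sub>+\<^sub>1\<close> and \<open>V\<^sub>L\<^sub>+\<^sub>3\<close> carry. On residues modulo 4 it is
  \<open>l \<mapsto> 2 L - l\<close>, which reverses the cyclic order of the labels; this is why it matches the string
  read forwards from the turning point with the string read backwards.
\<close>

definition label_swap :: "nat \<Rightarrow> nat \<Rightarrow> nat" where
  "label_swap L = (if even L then Transposition.transpose 1 3 else Transposition.transpose 2 4)"

lemma label_swap_range: "l \<in> {1..4} \<Longrightarrow> label_swap L l \<in> {1..4}"
  by (auto simp: label_swap_def Transposition.transpose_def)

lemma label_swap_swap: "label_swap L (label_swap L l) = l"
  by (simp add: label_swap_def)

lemma two_steps_mod_4: "(2 * L + 2) mod 4 = (if even L then 2 else (0 :: nat))"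
proof (cases "even L")
  case True
  then obtain u where "L = 2 * u" by (rule evenE)
  then have "2 * L + 2 = 2 + u * 4" by simp
  then show ?thesis using True by (simp only: mod_mult_self1) simp
next
  case False
  then obtain u where "L = 2 * u + 1" by (rule oddE)
  then have "2 * L + 2 = 0 + (u + 1) * 4" by simp
  then show ?thesis using False by (simp only: mod_mult_self1) simp
qed

lemma label_swap_mod:
  assumes "(x + y) mod 4 = (2 * L + 2) mod 4"
  shows "label_swap L (x mod 4 + 1) = y mod 4 + 1"
proof -
  define a b where "a = x mod 4" "b = y mod 4"
  have "a < 4" "b < 4" by (simp_all add: a_b_def)
  then have "a = 0 \<or> a = 1 \<or> a = 2 \<or> a = 3" "b = 0 \<or> b = 1 \<or> b = 2 \<or> b = 3"
    by linarith+
  moreover have "(a + b) mod 4 = (if even L then 2 else 0)"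
    using assms unfolding a_b_def mod_add_eq two_steps_mod_4 by simp
  ultimately have "label_swap L (a + 1) = b + 1"
    by (cases "even L"; elim disjE; simp add: label_swap_def Transposition.transpose_def)
  then show ?thesis by (simp add: a_b_def)
qed

text \<open>
  Relabelling a tetrahedron relabels its faces.
\<close>

lemma vertex_flip_label_swap:
  assumes "i \<in> {1..4}"
  shows "vertex_flip i (\<lambda>l. T (label_swap L l)) l = vertex_flip (label_swap L i) T (label_swap L l)"
proof (cases "l = i")
  case True
  have "T (label_swap L 1) + T (label_swap L 2) + T (label_swap L 3) + T (label_swap L 4) = T 1 + T 2 + T 3 + T 4"
    by (simp add: label_swap_def Transposition.transpose_def algebra_simps)
  then show ?thesis
    unfolding True vertex_flip_at[OF assms] vertex_flip_at[OF label_swap_range[OF assms]] by simp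
next
  case False
  then have "label_swap L l \<noteq> label_swap L i" by (metis label_swap_swap)
  then show ?thesis using False by (simp add: vertex_flip_other)
qed

section \<open>The string of the quadrahelix\<close>

lemma S_string_nth: "k < m \<Longrightarrow> S_string m ! k = (k + 1) mod 4 + 1"
  by (simp add: S_string_def nth_append del: upt_Suc)

lemma length_S_string: "length (S_string m) = m"
  by (simp add: S_string_def)

lemma length_Sigma_string: "length (Sigma_string (2 * L)) = 2 * L"
  by (simp add: Sigma_string_def delete_middle_def length_S_string)

lemma Sigma_string_nth:
  assumes "k < 2 * L"
  shows "Sigma_string (2 * L) ! k = (if k < L then (k + 1) mod 4 + 1 else (k + 2) mod 4 + 1)"
  using assms by (simp add: Sigma_string_def delete_middle_def length_S_string nth_append min_def S_string_nth)

lemma QH_string_nth_helix: "k \<le> L \<Longrightarrow> QH_string L ! k = k mod 4 + 1"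
  by (cases k) (auto simp: QH_string_def nth_append length_Sigma_string Sigma_string_nth)

text \<open>
  Deleting the middle entry shifts the cycle by one. The case \<open>n = L\<close> shows that \<open>j\<close>, whose value
  depends on the parity of \<open>L\<close>, is just the continuation of the shifted cycle.
\<close>

lemma QH_string_nth_second:
  assumes "n \<le> L"
  shows "QH_string L ! (L + 1 + n) = (L + 2 + n) mod 4 + 1"
proof (cases "n = L")
  case True
  have "(if even L then 3 else 1) = (2 * L + 2) mod 4 + 1" unfolding two_steps_mod_4 by simp
  moreover have "QH_string L ! (2 * L + 1) = (if even L then 3 else 1)"
    by (simp add: QH_string_def nth_append length_Sigma_string)
  ultimately show ?thesis using True by (simp add: mult_2)
next
  case False
  then show ?thesis using assms
    by (simp add: QH_string_def nth_append length_Sigma_string Sigma_string_nth)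
qed

text \<open>
  The string is a palindrome about \<open>j\<close>, except for the initial 1.
\<close>

lemma QH_string_nth_mirror:
  assumes "n < 2 * L"
  shows "QH_string L ! (2 * L + 2 + n) = QH_string L ! (2 * L - n)"
proof -
  have "QH_string L ! (2 * L + 2 + n) = Sigma_string (2 * L) ! (2 * L - Suc n)"
    using assms by (simp add: QH_string_def nth_append length_Sigma_string rev_nth)
  also have "\<dots> = QH_string L ! (2 * L - n)"
    using assms by (simp add: QH_string_def nth_append length_Sigma_string nth_Cons')
  finally show ?thesis .
qed

lemma QH_string_range:
  assumes "k < 4 * L + 2"
  shows "QH_string L ! k \<in> {1..4}"
proof -
  have low: "QH_string L ! k \<in> {1..4}" if "k \<le> 2 * L + 1" for k
    using QH_string_nth_helix[of k L] QH_string_nth_second[of "k - (L + 1)" L] that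
    by (cases "k \<le> L") (simp_all add: Suc_le_eq)
  show ?thesis
  proof (cases "k \<le> 2 * L + 1")
    case False
    define n where "n = k - (2 * L + 2)"
    have "k = 2 * L + 2 + n" "n < 2 * L" using False assms by (auto simp: n_def)
    then show ?thesis using low[of "2 * L - n"] QH_string_nth_mirror[of n L] by simp
  qed (rule low)
qed

section \<open>The two arms and the two halves\<close>

lemma unit_regular_QH: "k \<le> 4 * L + 2 \<Longrightarrow> unit_regular (QH L k)"
proof (induction k)
  case 0
  show ?case
    unfolding unit_regular_def QH_def chain_tet.simps T_init_def
    by (intro ballI impI dist_helix_V) auto
next
  case (Suc k)
  then show ?case using reflect_in_face_regular(2)[OF _ QH_string_range[of k L]] by (simp add: QH_def)
qed

text \<open>
  Every tetrahedron of the chain is regular, so reflecting in a face may be computed by the affine formula.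
\<close>

lemma QH_Suc:
  assumes "k < 4 * L + 2"
  shows "QH L (Suc k) = vertex_flip (QH_string L ! k) (QH L k)"
  using reflect_in_face_regular(1)[OF unit_regular_QH[of k L] QH_string_range[OF assms]] assms
  by (simp add: QH_def)

lemma QH_helix:
  assumes "k \<le> L + 1"
  shows "agree (QH L k) (helix_tet k)"
  using assms
proof (induction k)
  case 0
  have "helix_tet 0 l = T_init l" if "l \<in> {1..4}" for l
    using that by (auto simp: helix_tet_def T_init_def)
  then show ?case by (simp add: agree_def QH_def)
next
  case (Suc k)
  have i: "k mod 4 + 1 \<in> {1..4}" by (simp add: Suc_le_eq)
  have "QH L (Suc k) = vertex_flip (k mod 4 + 1) (QH L k)"
    using Suc.prems QH_Suc[of k L] QH_string_nth_helix[of k L] by simp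
  moreover have "agree (QH L k) (helix_tet k)" using Suc by simp
  ultimately show ?case
    using agree_trans[OF agree_vertex_flip[OF _ i] helix_tet_step] by simp
qed

text \<open>
  The mirror that exchanges \<open>V\<^sub>L\<^sub>+\<^sub>1\<close> and \<open>V\<^sub>L\<^sub>+\<^sub>3\<close> and so carries the tetrahedron at the turning point to itself.
\<close>

definition arm_mirror :: "nat \<Rightarrow> real ^ 3 \<Rightarrow> real ^ 3" where
  "arm_mirror L = mirror (bisector_normal (int L + 2)) (helix_V (int L + 2))"

lemma arm_mirror_helix:
  "arm_mirror L (helix_V (int L)) = helix_V (int L)"
  "arm_mirror L (helix_V (int L + 1)) = helix_V (int L + 3)"
  "arm_mirror L (helix_V (int L + 2)) = helix_V (int L + 2)"
  "arm_mirror L (helix_V (int L + 3)) = helix_V (int L + 1)"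
proof -
  define b where "b = int L + 2"
  note near = bisector_normal_inner_near[of b] and unit = bisector_normal_unit[of b]
  have e: "int L = b - 2" "int L + 1 = b - 1" "int L + 2 = b" "int L + 3 = b + 1" by (auto simp: b_def)
  show "arm_mirror L (helix_V (int L)) = helix_V (int L)"
    using mirror_eqI[OF unit, of "helix_V (b - 2)" "helix_V b" 0] near
    unfolding arm_mirror_def e by simp
  show "arm_mirror L (helix_V (int L + 1)) = helix_V (int L + 3)"
    using mirror_eqI[OF unit, of "helix_V (b - 1)" "helix_V b" "-1"] near
    unfolding arm_mirror_def e by (simp add: bisector_normal_def add.commute)
  show "arm_mirror L (helix_V (int L + 2)) = helix_V (int L + 2)"
    unfolding arm_mirror_def e by (simp add: mirror_def)
  show "arm_mirror L (helix_V (int L + 3)) = helix_V (int L + 1)"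
    using mirror_eqI[OF unit, of "helix_V (b + 1)" "helix_V b" "1"] near
    unfolding arm_mirror_def e by (simp add: bisector_normal_def add.commute)
qed

text \<open>
  The start of the induction for the second arm: at the turning point, the geometric exchange of
  \<open>V\<^sub>L\<^sub>+\<^sub>1\<close> and \<open>V\<^sub>L\<^sub>+\<^sub>3\<close> undoes the exchange of their labels.
\<close>

lemma arm_mirror_fixes_middle:
  "agree (helix_tet (L + 1)) (\<lambda>l. arm_mirror L (helix_tet (L + 1) (label_swap L l)))"
  unfolding agree_def
proof
  fix l :: nat assume "l \<in> {1..4}"
  then obtain d where d: "d < 4" "l = (L + 1 + d) mod 4 + 1" by (rule label_cases)
  \<comment> \<open>The position in the window to which the swap moves position \<open>d\<close>: it exchanges 1 and 3.\<close>
  define e where "e = (if d = 0 then 0 else 4 - d)"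
  have cases: "d = 0 \<and> e = 0 \<or> d = 1 \<and> e = 3 \<or> d = 2 \<and> e = 2 \<or> d = 3 \<and> e = 1"
    using d(1) unfolding e_def by arith
  have "L + 1 + d + (L + 1 + e) = 2 * L + 2 \<or> L + 1 + d + (L + 1 + e) = 2 * L + 2 + 4" "e < 4"
    using cases by auto
  then have e: "(L + 1 + d + (L + 1 + e)) mod 4 = (2 * L + 2) mod 4" "e < 4" by (metis mod_add_self2)+
  have "label_swap L l = (L + 1 + e) mod 4 + 1"
    unfolding d(2) by (rule label_swap_mod) (use e in simp)
  then have "helix_tet (L + 1) (label_swap L l) = helix_V (int L + int e)"
    using helix_tet_label[of _ "L + 1" e] e by simp
  moreover have "helix_tet (L + 1) l = helix_V (int L + int d)"
    using helix_tet_label[of _ "L + 1" d] d by simp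
  ultimately show "helix_tet (L + 1) l = arm_mirror L (helix_tet (L + 1) (label_swap L l))"
    using arm_mirror_helix[of L] cases by auto
qed

text \<open>
  Beyond the turning point the chain runs along the mirrored helix back to its start. By
  equivariance, a step forwards from the mirrored, relabelled \<open>T\<^sub>m\<^sub>+\<^sub>1\<close> is a step back to \<open>T\<^sub>m\<close>, as
  \<open>label_swap\<close> sends the label used here to the label that led from \<open>T\<^sub>m\<close> to \<open>T\<^sub>m\<^sub>+\<^sub>1\<close>. The case
  \<open>n = L + 1\<close> goes one step further, to the image of the auxiliary tetrahedron \<open>T\<^sub>0\<close>, and is used to identify
  the plane of the second mirror.
\<close>

lemma QH_second_arm:
  assumes "n \<le> L + 1"
  shows "agree (QH L (L + 1 + n)) (\<lambda>l. arm_mirror L (helix_tet (L + 1 - n) (label_swap L l)))"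
  using assms
proof (induction n)
  case 0
  show ?case using agree_trans[OF QH_helix[of "L + 1" L] arm_mirror_fixes_middle] by simp
next
  case (Suc n)
  define r where "r = (L + 2 + n) mod 4 + 1"
  define T where "T = helix_tet (L + 1 - n)"
  have r: "r \<in> {1..4}" by (simp add: r_def Suc_le_eq)
  have swap: "label_swap L r = (L - n) mod 4 + 1"
    unfolding r_def using Suc.prems by (intro label_swap_mod) (simp add: mult_2)
  have "QH L (L + 1 + Suc n) = vertex_flip r (QH L (L + 1 + n))"
    using Suc.prems QH_Suc[of "L + 1 + n" L] QH_string_nth_second[of n L] by (simp add: r_def)
  moreover have "agree (vertex_flip r (QH L (L + 1 + n))) (vertex_flip r (\<lambda>l. arm_mirror L (T (label_swap L l))))"
    using agree_vertex_flip[OF Suc.IH r] Suc.prems by (simp add: T_def)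
  moreover have "vertex_flip r (\<lambda>l. arm_mirror L (T (label_swap L l))) l
      = arm_mirror L (vertex_flip (label_swap L r) T (label_swap L l))" for l
    using mirror_vertex_flip[OF r, of _ _ "\<lambda>l. T (label_swap L l)"] vertex_flip_label_swap[OF r, of T]
    unfolding arm_mirror_def comp_def by metis
  moreover have "agree (vertex_flip (label_swap L r) T) (helix_tet (L + 1 - Suc n))"
    using helix_tet_step_back[of "L - n"] Suc.prems unfolding swap T_def by (simp add: Suc_diff_le)
  ultimately show ?case using label_swap_range unfolding agree_def by simp
qed

text \<open>
  The mirror in the plane of \<open>V\<^sub>0\<close>, \<open>V\<^sub>1\<close>, \<open>V\<^sub>2\<close>, the common face of \<open>T\<^sub>0\<close> and \<open>T\<^sub>1\<close>.
\<close>

definition end_mirror :: "real ^ 3 \<Rightarrow> real ^ 3" where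
  "end_mirror = mirror (face_normal 1) (helix_V 1)"

lemma end_mirror_helix:
  "end_mirror (helix_V 0) = helix_V 0" "end_mirror (helix_V 1) = helix_V 1"
  "end_mirror (helix_V 2) = helix_V 2" "end_mirror (helix_V 3) = helix_V (-1)"
proof -
  have fixed: "end_mirror (helix_V k) = helix_V k" if "k \<in> {0, 1, 2}" for k
  proof -
    have "sine_gap (k - 1) = 0" using that by (auto simp: sine_gap_def)
    then have "(helix_V k - helix_V 1) \<bullet> face_normal 1 = 0"
      using face_normal_inner[of 1 k] by (metis inner_commute mult_zero_right)
    then show ?thesis unfolding end_mirror_def mirror_def by simp
  qed
  show "end_mirror (helix_V 0) = helix_V 0" "end_mirror (helix_V 1) = helix_V 1"
    "end_mirror (helix_V 2) = helix_V 2" using fixed by auto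
  \<comment> \<open>The factor \<open>2 h r (2 sin \<theta> - sin 2\<theta>) / (1/4)\<close> of the normal in the formula of the mirror.\<close>
  define q where "q = helix_h * helix_r * sin helix_theta * (80 / 3)"
  have nn: "face_normal 1 \<bullet> face_normal 1 = 1 / 4"
  proof -
    have "face_normal 1 \<bullet> face_normal 1
      = helix_h\<^sup>2 * (sin helix_theta)\<^sup>2 + helix_h\<^sup>2 * (cos helix_theta)\<^sup>2 + helix_r\<^sup>2 * (sin helix_theta)\<^sup>2"
      unfolding inner_3 by (simp add: power2_eq_square algebra_simps)
    then show ?thesis by (simp add: helix_h_sq helix_r_sq sin_theta_sq cos_theta power_divide)
  qed
  have "(helix_V 3 - helix_V 1) \<bullet> face_normal 1 = helix_h * helix_r * sine_gap 2"
    using face_normal_inner[of 1 3] by (simp add: inner_commute)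
  then have "end_mirror (helix_V 3) = helix_V 3 - q *\<^sub>R face_normal 1"
    unfolding end_mirror_def mirror_def nn by (simp add: sine_gap_def sin_multiples q_def)
  also have "\<dots> = helix_V (-1)"
  proof -
    have "q * (helix_h * sin helix_theta) = 80 / 3 * helix_h\<^sup>2 * (sin helix_theta)\<^sup>2 * helix_r"
      "q * (helix_h * cos helix_theta) = 80 / 3 * helix_h\<^sup>2 * cos helix_theta * (helix_r * sin helix_theta)"
      "q * (helix_r * sin helix_theta) = 80 / 3 * helix_r\<^sup>2 * (sin helix_theta)\<^sup>2 * helix_h"
      by (simp_all add: q_def power2_eq_square)
    then have q: "q * (helix_h * sin helix_theta) = 40 / 27 * helix_r"
      "q * (helix_h * cos helix_theta) = - 16 / 9 * (helix_r * sin helix_theta)"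
      "q * (helix_r * sin helix_theta) = 4 * helix_h"
      unfolding helix_h_sq helix_r_sq sin_theta_sq cos_theta by simp_all
    have "helix_r * cos (3 * helix_theta) - q * (helix_h * sin helix_theta) = helix_r * cos helix_theta"
      "helix_r * sin (3 * helix_theta) + q * (helix_h * cos helix_theta) = - (helix_r * sin helix_theta)"
      "3 * helix_h - q * (helix_r * sin helix_theta) = - helix_h"
      unfolding q unfolding cos_multiples sin_multiples cos_theta by simp_all
    then show ?thesis by (simp add: vec_eq_iff forall_3)
  qed
  finally show "end_mirror (helix_V 3) = helix_V (-1)" .
qed

lemma end_mirror_first:
  assumes "l \<in> {1..4}"
  shows "helix_tet 0 l = end_mirror (helix_tet 1 l)"
proof -
  have "l = 1 \<or> l = 2 \<or> l = 3 \<or> l = 4" using assms by auto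
  then show ?thesis using end_mirror_helix by (auto simp: helix_tet_def)
qed

text \<open>
  The mirror in the face of \<open>T\<^sub>2\<^sub>L\<^sub>+\<^sub>1\<close> opposite to the vertex labelled \<open>j\<close>. As \<open>T\<^sub>2\<^sub>L\<^sub>+\<^sub>1\<close> is the image
  of \<open>T\<^sub>1\<close> under the first mirror, it is the conjugate of the mirror in the plane of \<open>V\<^sub>0\<close>, \<open>V\<^sub>1\<close>, \<open>V\<^sub>2\<close>;
  in this form all heights can be computed on the original helix.
\<close>

definition loop_mirror :: "nat \<Rightarrow> real ^ 3 \<Rightarrow> real ^ 3" where
  "loop_mirror L x = arm_mirror L (end_mirror (arm_mirror L x))"

lemma loop_mirror_vertex_flip:
  assumes "i \<in> {1..4}"
  shows "loop_mirror L (vertex_flip i T l) = vertex_flip i (\<lambda>l. loop_mirror L (T l)) l"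
  unfolding loop_mirror_def arm_mirror_def end_mirror_def mirror_vertex_flip[OF assms] comp_def ..

text \<open>
  Both \<open>T\<^sub>2\<^sub>L\<^sub>+\<^sub>2\<close> and \<open>T\<^sub>2\<^sub>L\<^sub>+\<^sub>1\<close> are known from the second arm, as the images of \<open>T\<^sub>0\<close> and
  \<open>T\<^sub>1\<close>. After that, the palindromic string retraces the first half in the mirror, each step undoing
  an earlier one.
\<close>

lemma QH_second_half:
  assumes "n \<le> 2 * L"
  shows "agree (QH L (2 * L + 2 + n)) (\<lambda>l. loop_mirror L (QH L (2 * L + 1 - n) l))"
  using assms
proof (induction n)
  case 0
  have "agree (QH L (2 * L + 2)) (\<lambda>l. arm_mirror L (helix_tet 0 (label_swap L l)))"
    using QH_second_arm[of "L + 1" L] by (simp add: mult_2)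
  moreover have "agree (QH L (2 * L + 1)) (\<lambda>l. arm_mirror L (helix_tet 1 (label_swap L l)))"
    using QH_second_arm[of L L] by (simp add: mult_2)
  ultimately show ?case
    using end_mirror_first[OF label_swap_range]
    by (simp add: agree_def loop_mirror_def arm_mirror_def)
next
  case (Suc n)
  define r where "r = QH_string L ! (2 * L - n)"
  have r: "r \<in> {1..4}" unfolding r_def using Suc.prems by (intro QH_string_range) simp
  have "QH L (2 * L + 2 + Suc n) = vertex_flip r (QH L (2 * L + 2 + n))"
    using QH_Suc[of "2 * L + 2 + n" L] QH_string_nth_mirror[of n L] Suc.prems by (simp add: r_def)
  moreover have "agree (vertex_flip r (QH L (2 * L + 2 + n)))
      (\<lambda>l. loop_mirror L (vertex_flip r (QH L (2 * L + 1 - n)) l))"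
    unfolding loop_mirror_vertex_flip[OF r]
    using agree_vertex_flip[OF Suc.IH r] Suc.prems by simp
  moreover have "vertex_flip r (QH L (2 * L + 1 - n)) = QH L (2 * L + 1 - Suc n)"
    using QH_Suc[of "2 * L - n" L] Suc.prems vertex_flip_flip[OF r] by (simp add: r_def Suc_diff_le)
  ultimately show ?case by simp
qed

section \<open>Separation of the tetrahedra\<close>

text \<open>
  The face on \<open>V\<^sub>i\<close>, \<open>V\<^sub>i\<^sub>+\<^sub>1\<close>, \<open>V\<^sub>i\<^sub>+\<^sub>2\<close>, through which the chain leaves the earlier tetrahedron, separates
  it from all later ones.
\<close>

lemma helix_separated:
  assumes "i < j"
  shows "separated (helix_tet i) (helix_tet j)"
  unfolding separated_def
proof (intro exI conjI ballI)
  define a where "a = int i + 1"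
  show "face_normal a \<noteq> 0" by (rule face_normal_nonzero)
  fix l :: nat assume l: "l \<in> {1..4}"
  have val: "face_normal a \<bullet> helix_V n = face_normal a \<bullet> helix_V a + helix_h * helix_r * sine_gap (n - a)" for n
    using face_normal_inner[of a n] by (simp add: inner_diff_right)
  obtain n where "helix_tet i l = helix_V n" "n \<le> int i + 2" using helix_tet_range[OF l] by metis
  then show "face_normal a \<bullet> helix_tet i l \<le> face_normal a \<bullet> helix_V a"
    using val[of n] sine_gap_nonpos[of "n - a"] helix_rh_pos by (simp add: a_def mult_nonneg_nonpos)
  obtain n where "helix_tet j l = helix_V n" "int j - 1 \<le> n" using helix_tet_range[OF l] by metis
  then show "face_normal a \<bullet> helix_V a \<le> face_normal a \<bullet> helix_tet j l"
    using val[of n] sine_gap_nonneg[of "n - a"] helix_rh_pos assms by (simp add: a_def)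
qed

text \<open>
  All vertices of the arm before the turning point have index at most \<open>L + 2\<close>, so they lie on one
  side of the first mirror, and their images on the other.
\<close>

lemma arms_separated:
  assumes "i \<le> L" "k \<le> L"
  shows "separated (helix_tet i) (\<lambda>l. arm_mirror L (helix_tet k (label_swap L l)))"
  unfolding separated_def
proof (intro exI conjI ballI)
  define b where "b = int L + 2"
  show "bisector_normal b \<noteq> 0" using bisector_normal_unit[of b] by auto
  fix l :: nat assume l: "l \<in> {1..4}"
  have below: "(helix_tet m l' - helix_V b) \<bullet> bisector_normal b \<le> 0" if "m \<le> L" "l' \<in> {1..4}" for m l'
  proof -
    obtain n where "helix_tet m l' = helix_V n" "n \<le> int m + 2" using helix_tet_range[OF \<open>l' \<in> {1..4}\<close>] by metis
    then show ?thesis using bisector_separates[of n b] that(1) by (simp add: b_def)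
  qed
  show "bisector_normal b \<bullet> helix_tet i l \<le> bisector_normal b \<bullet> helix_V b"
    using below[OF assms(1) l] by (simp add: inner_diff_left inner_diff_right inner_commute)
  have "(arm_mirror L (helix_tet k (label_swap L l)) - helix_V b) \<bullet> bisector_normal b \<ge> 0"
    unfolding arm_mirror_def b_def[symmetric] inner_mirror
    using below[OF assms(2) label_swap_range[OF l]] by simp
  then show "bisector_normal b \<bullet> helix_V b \<le> bisector_normal b \<bullet> arm_mirror L (helix_tet k (label_swap L l))"
    by (simp add: inner_diff_left inner_diff_right inner_commute)
qed

lemma separated_relabel:
  assumes "separated T T'"
  shows "separated (\<lambda>l. T (label_swap L l)) (\<lambda>l. T' (label_swap L l))"
  using assms label_swap_range unfolding separated_def by meson

lemma first_half_separated:
  assumes "1 \<le> i" "i < j" "j \<le> 2 * L + 1"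
  shows "separated (QH L i) (QH L j)"
proof (cases "j \<le> L + 1")
  case True
  then show ?thesis
    using separated_agree[OF helix_separated[OF assms(2)]] QH_helix[of i L] QH_helix[of j L] assms by simp
next
  case False
  define q where "q = j - (L + 1)"
  have q: "j = L + 1 + q" "1 \<le> q" "q \<le> L" using False assms by (auto simp: q_def)
  have J: "agree (QH L j) (\<lambda>l. arm_mirror L (helix_tet (L + 1 - q) (label_swap L l)))"
    unfolding q(1) using q by (intro QH_second_arm) simp
  show ?thesis
  proof (cases "i \<le> L")
    case True
    show ?thesis
      using separated_agree[OF arms_separated[OF True, of "L + 1 - q"] QH_helix[of i L] J] True q by simp
  next
    case False
    define p where "p = i - (L + 1)"
    have p: "i = L + 1 + p" "p < q" using False assms q by (auto simp: p_def)
    have I: "agree (QH L i) (\<lambda>l. arm_mirror L (helix_tet (L + 1 - p) (label_swap L l)))"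
      unfolding p(1) using p q by (intro QH_second_arm) simp
    have "separated (helix_tet (L + 1 - q)) (helix_tet (L + 1 - p))"
      using p q by (intro helix_separated) simp
    then have "separated (\<lambda>l. helix_tet (L + 1 - p) (label_swap L l)) (\<lambda>l. helix_tet (L + 1 - q) (label_swap L l))"
      by (rule separated_relabel[OF separated_commute])
    then have "separated (\<lambda>l. arm_mirror L (helix_tet (L + 1 - p) (label_swap L l)))
        (\<lambda>l. arm_mirror L (helix_tet (L + 1 - q) (label_swap L l)))"
      unfolding arm_mirror_def by (rule separated_mirrorI)
    then show ?thesis using I J by (rule separated_agree)
  qed
qed

lemma helix_above_first_face:
  assumes "1 \<le> k" "l \<in> {1..4}"
  shows "0 \<le> (helix_tet k l - helix_V 1) \<bullet> face_normal 1"
proof -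
  obtain n where "helix_tet k l = helix_V n" "int k - 1 \<le> n" using helix_tet_range[OF assms(2)] by metis
  then show ?thesis
    using face_normal_inner[of 1 n] sine_gap_nonneg[of "n - 1"] helix_rh_pos assms(1)
    by (simp add: inner_commute)
qed

text \<open>
  The decisive estimate. The vertices lie behind the first mirror, so the mirror moves them by a
  nonnegative multiple of its normal \<open>m\<close>. As \<open>m\<close> makes no obtuse angle with the normal of the
  first face, the movement does not decrease their height above that face, which is nonnegative from the outset.
\<close>

lemma mirrored_arm_above_first_face:
  assumes "1 \<le> k" "k \<le> L" "l \<in> {1..4}"
  shows "0 \<le> (arm_mirror L (helix_tet k l) - helix_V 1) \<bullet> face_normal 1"
proof -
  define b where "b = int L + 2"
  define s where "s = (helix_tet k l - helix_V b) \<bullet> bisector_normal b"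
  obtain n where "helix_tet k l = helix_V n" "n \<le> int k + 2" using helix_tet_range[OF assms(3)] by metis
  then have "s \<le> 0" using bisector_separates[of n b] assms(2) by (simp add: b_def s_def)
  then have "0 \<le> - 2 * s * (face_normal 1 \<bullet> bisector_normal b)"
    using normals_acute[of 1 b] by (simp add: mult_nonpos_nonneg)
  moreover have "arm_mirror L (helix_tet k l) = helix_tet k l - (2 * s) *\<^sub>R bisector_normal b"
    unfolding arm_mirror_def b_def[symmetric] by (intro mirror_eqI bisector_normal_unit) (simp add: s_def)
  ultimately show ?thesis
    using helix_above_first_face[OF assms(1,3)]
    by (simp add: inner_diff_left inner_diff_right inner_commute)
qed

text \<open>
  Transported back by the first mirror, this says that the whole first half of the chain lies on one
  side of the second mirror. For the second arm the first mirror cancels and only the height on the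
  original helix remains; the tetrahedron at the turning point is treated as a member of the second arm.
\<close>

lemma first_half_above_first_face:
  assumes "1 \<le> k" "k \<le> 2 * L + 1" "l \<in> {1..4}"
  shows "0 \<le> (arm_mirror L (QH L k l) - helix_V 1) \<bullet> face_normal 1"
proof (cases "k \<le> L")
  case True
  then have "QH L k l = helix_tet k l" using QH_helix[of k L] assms(3) by (simp add: agree_def)
  then show ?thesis using mirrored_arm_above_first_face[OF assms(1) True assms(3)] by simp
next
  case False
  define n where "n = k - (L + 1)"
  have n: "k = L + 1 + n" "n \<le> L" using False assms by (auto simp: n_def)
  have "QH L k l = arm_mirror L (helix_tet (L + 1 - n) (label_swap L l))"
    using QH_second_arm[of n L] n assms(3) by (simp add: agree_def)
  then have "arm_mirror L (QH L k l) = helix_tet (L + 1 - n) (label_swap L l)"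
    by (simp add: arm_mirror_def)
  then show ?thesis
    using helix_above_first_face[OF _ label_swap_range[OF assms(3)]] n by simp
qed

lemma halves_separated:
  assumes "1 \<le> i" "i \<le> 2 * L + 1" "1 \<le> k" "k \<le> 2 * L + 1"
  shows "separated (QH L i) (\<lambda>l. loop_mirror L (QH L k l))"
proof -
  have "separated (\<lambda>l. end_mirror (arm_mirror L (QH L k l))) (\<lambda>l. arm_mirror L (QH L i l))"
    unfolding separated_def
  proof (intro exI conjI ballI)
    show "face_normal 1 \<noteq> 0" by (rule face_normal_nonzero)
    fix l :: nat assume l: "l \<in> {1..4}"
    show "face_normal 1 \<bullet> helix_V 1 \<le> face_normal 1 \<bullet> arm_mirror L (QH L i l)"
      using first_half_above_first_face[OF assms(1,2) l] by (simp add: inner_diff_left inner_diff_right inner_commute)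
    have "(end_mirror (arm_mirror L (QH L k l)) - helix_V 1) \<bullet> face_normal 1 \<le> 0"
      unfolding end_mirror_def inner_mirror using first_half_above_first_face[OF assms(3,4) l] by simp
    then show "face_normal 1 \<bullet> end_mirror (arm_mirror L (QH L k l)) \<le> face_normal 1 \<bullet> helix_V 1"
      by (simp add: inner_diff_left inner_diff_right inner_commute)
  qed
  then have "separated (\<lambda>l. arm_mirror L (QH L i l)) (\<lambda>l. arm_mirror L (loop_mirror L (QH L k l)))"
    by (simp add: separated_commute loop_mirror_def arm_mirror_def)
  then show ?thesis unfolding arm_mirror_def by (rule separated_mirrorD)
qed

lemma separated_loop_mirror:
  assumes "separated T T'"
  shows "separated (\<lambda>l. loop_mirror L (T l)) (\<lambda>l. loop_mirror L (T' l))"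
  unfolding loop_mirror_def arm_mirror_def end_mirror_def
  by (intro separated_mirrorI assms)

theorem theorem4:
  fixes L i j :: nat
  assumes "L > 0" and "1 \<le> i" and "i < j" and "j \<le> 4 * L + 2"
  shows "interior (solid (QH L i)) \<inter> interior (solid (QH L j)) = {}"
proof (rule separated_interior)
  show "separated (QH L i) (QH L j)"
  proof (cases "j \<le> 2 * L + 1")
    case True
    then show ?thesis using first_half_separated assms by blast
  next
    case False
    define q where "q = j - (2 * L + 2)"
    have q: "j = 2 * L + 2 + q" "q \<le> 2 * L" using False assms by (auto simp: q_def)
    have J: "agree (QH L j) (\<lambda>l. loop_mirror L (QH L (2 * L + 1 - q) l))"
      unfolding q(1) by (rule QH_second_half[OF q(2)])
    show ?thesis
    proof (cases "i \<le> 2 * L + 1")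
      case True
      have "separated (QH L i) (\<lambda>l. loop_mirror L (QH L (2 * L + 1 - q) l))"
        using True assms q by (intro halves_separated) auto
      then show ?thesis by (rule separated_agree) (use J in \<open>auto simp: agree_def\<close>)
    next
      case False
      define p where "p = i - (2 * L + 2)"
      have p: "i = 2 * L + 2 + p" "p < q" using False assms q by (auto simp: p_def)
      have I: "agree (QH L i) (\<lambda>l. loop_mirror L (QH L (2 * L + 1 - p) l))"
        unfolding p(1) using p q by (intro QH_second_half) simp
      have "separated (QH L (2 * L + 1 - q)) (QH L (2 * L + 1 - p))"
        using p q by (intro first_half_separated) auto
      then have "separated (\<lambda>l. loop_mirror L (QH L (2 * L + 1 - p) l)) (\<lambda>l. loop_mirror L (QH L (2 * L + 1 - q) l))"
        by (rule separated_loop_mirror[OF separated_commute])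
      then show ?thesis using I J by (rule separated_agree)
    qed
  qed
qed

end
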